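(* Let $k\in\{1,0,-1\}$, let $(\Sigma,g_\Sigma)$ be correspondingly $S^3$, $\mathbb{R}^3$ or $H^3$ with its standard metric of constant curvature $k$, let $I\subseteq\mathbb{R}$ be an interval, and let $a:I\to\mathbb{R}$ be a function (which is allowed to vanish). Consider the FLRW spacetime $I\times\Sigma$ with the (possibly degenerate) metric $g=-dt^2+a^2(t)\,g_\Sigma$, and let $\rho(t)$ and $p(t)$ be defined at all $t\in I$ with $a(t)\neq 0$ by the Friedmann equation and the acceleration equation $$\rho=\frac{3}{\kappa}\,\frac{\dot a^2+k}{a^2},\qquad \rho+3p=-\frac{6}{\kappa}\,\frac{\ddot a}{a}.$$ Let $T_{ab}=(\rho+p)u_au_b+p\,g_{ab}$ with $u=\partial_t$. In any local coordinates $(x,y,z)$ on $\Sigma$, with $\sqrt{-g}=a^3\sqrt{g_\Sigma}$, put $$\widetilde\rho=\rho\sqrt{-g}=\rho\,a^3\sqrt{g_\Sigma},\qquad \widetilde p=p\sqrt{-g}=p\,a^3\sqrt{g_\Sigma}.$$ If $a$ is a smooth function on $I$, then the densities $\widetilde\rho$, $\widetilde p$ and the densitized stress-energy tensor $T_{ab}\sqrt{-g}$ (that is, all its components in the coordinates $(t,x,y,z)$) are smooth, including at the moments $t_0$ with $a(t_0)=0$; i.e. they are given, wherever $a\neq0$, by functions that are defined and smooth for all $t\in I$ and all points of the coordinate domain in $\Sigma$.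
   Context: Smooth means $C^\infty$. Dots denote derivatives with respect to $t$. The constant $\kappa>0$ is $8\pi\mathcal{G}/c^4$ with units in which $\mathcal{G}=c=1$; the cosmological constant is omitted, since it can be absorbed by $\rho\to\rho+\kappa^{-1}\Lambda$, $p\to p-\kappa^{-1}\Lambda$. In spherical coordinates the metric on $\Sigma$ is $\frac{dr^2}{1-kr^2}+r^2(d\theta^2+\sin^2\theta\,d\phi^2)$. The symbol $\sqrt{g_\Sigma}$ denotes the square root of the determinant of the matrix of $g_\Sigma$ in the chosen local coordinates $(x,y,z)$ on $\Sigma$; it is a smooth function independent of $t$. In the coordinates $(t,x,y,z)$ on $I\times\Sigma$, the convention $\sqrt{-g}:=a^3\sqrt{g_\Sigma}$ is used (with $a^3$, not $|a|^3$, also where $a<0$), so that the volume form is $a^3\sqrt{g_\Sigma}\,dt\wedge dx\wedge dy\wedge dz$. The scalars $\rho$ (mass density) and $p$ (pressure) describe a homogeneous isotropic fluid with four-velocity $u=\partial_t$, whose index is lowered with $g$: $u_a=g_{ab}u^b$. These scalars, and hence $T_{ab}$, are in general undefined or infinite where $a=0$. At such points $\widetilde\rho$, $\widetilde p$ and $T_{ab}\sqrt{-g}$ are understood through the equations obtained by multiplying the Friedmann and acceleration equations, and the definition of $T_{ab}$, by $\sqrt{-g}=a^3\sqrt{g_\Sigma}$ and cancelling the powers of $a$ in the denominators. *)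

theory Defs
  imports "HOL-Analysis.Analysis"
begin

text \<open>
  Smoothness. All derivatives are taken within the domain \<open>S\<close>, hence one-sided at endpoints of an
  interval that belong to it. For the domains used here (open sets, nondegenerate intervals, and
  products of the two) the derivative within \<open>S\<close> is unique, so the choice of \<open>f'\<close> is immaterial.
\<close>

primrec Ck_on :: "nat \<Rightarrow> 'a::real_normed_vector set \<Rightarrow> ('a \<Rightarrow> 'b::real_normed_vector) \<Rightarrow> bool" where
  "Ck_on 0 S f \<longleftrightarrow> continuous_on S f"
| "Ck_on (Suc n) S f \<longleftrightarrow>
     (\<exists>f'. (\<forall>x\<in>S. (f has_derivative f' x) (at x within S)) \<and> (\<forall>v. Ck_on n S (\<lambda>x. f' x v)))"

definition smooth_on :: "'a::real_normed_vector set \<Rightarrow> ('a \<Rightarrow> 'b::real_normed_vector) \<Rightarrow> bool" where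
  "smooth_on S f \<longleftrightarrow> (\<forall>n. Ck_on n S f)"

definition time_deriv :: "real set \<Rightarrow> (real \<Rightarrow> real) \<Rightarrow> real \<Rightarrow> real" where
  "time_deriv I f t = vector_derivative f (at t within I)"

text \<open>
  The three space forms as hypersurfaces of \<open>\<real> \<times> \<real>\<^sup>3\<close>: the unit sphere, the hyperplane
  \<open>{0} \<times> \<real>\<^sup>3\<close>, and the upper sheet of the hyperboloid. The metric is induced by the Euclidean inner
  product, and for the hyperboloid by the Minkowski form; the parametrization
  \<open>(sqrt (1 - k r\<^sup>2), r n)\<close> with \<open>n \<in> S\<^sup>2\<close> (for \<open>k = 0\<close>: \<open>(0, r n)\<close>)
  then gives \<open>dr\<^sup>2 / (1 - k r\<^sup>2) + r\<^sup>2 d\<Omega>\<^sup>2\<close>.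
\<close>

definition space_form :: "real \<Rightarrow> (real \<times> (real^3)) set" where
  "space_form k =
     (if k = 1 then sphere 0 1
      else if k = 0 then {0} \<times> UNIV
      else {x. 0 < fst x \<and> (fst x)\<^sup>2 - (norm (snd x))\<^sup>2 = 1})"

definition ambient_form :: "real \<Rightarrow> real \<times> (real^3) \<Rightarrow> real \<times> (real^3) \<Rightarrow> real" where
  "ambient_form k v w =
     (if k = -1 then - (fst v * fst w) + snd v \<bullet> snd w else v \<bullet> w)"

text \<open>
  Local coordinates \<open>(x, y, z)\<close> with coordinate range \<open>U\<close> are given by their inverse
  \<open>\<phi> : U \<rightarrow> \<Sigma>\<close>, a smooth immersion which is a homeomorphism onto an open subset of \<open>\<Sigma>\<close>.
\<close>

definition local_coords :: "real \<Rightarrow> (real^3) set \<Rightarrow> (real^3 \<Rightarrow> real \<times> (real^3)) \<Rightarrow> bool" where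
  "local_coords k U \<phi> \<longleftrightarrow>
     open U \<and> smooth_on U \<phi> \<and>
     (\<forall>q\<in>U. inj (frechet_derivative \<phi> (at q))) \<and>
     openin (top_of_set (space_form k)) (\<phi> ` U) \<and>
     (\<exists>\<psi>. homeomorphism U (\<phi> ` U) \<phi> \<psi>)"

definition space_metric ::
  "real \<Rightarrow> (real^3 \<Rightarrow> real \<times> (real^3)) \<Rightarrow> real^3 \<Rightarrow> real^3 \<Rightarrow> real^3 \<Rightarrow> real" where
  "space_metric k \<phi> q v w =
     ambient_form k (frechet_derivative \<phi> (at q) v) (frechet_derivative \<phi> (at q) w)"

definition space_metric_matrix ::
  "real \<Rightarrow> (real^3 \<Rightarrow> real \<times> (real^3)) \<Rightarrow> real^3 \<Rightarrow> real^3^3" where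
  "space_metric_matrix k \<phi> q = (\<chi> i j. space_metric k \<phi> q (axis i 1) (axis j 1))"

definition sqrt_det_space ::
  "real \<Rightarrow> (real^3 \<Rightarrow> real \<times> (real^3)) \<Rightarrow> real^3 \<Rightarrow> real" where
  "sqrt_det_space k \<phi> q = sqrt (det (space_metric_matrix k \<phi> q))"

text \<open>
  Points \<open>(t, q)\<close> and tangent vectors of spacetime in the coordinates \<open>(t, x, y, z)\<close> are elements of
  \<open>\<real> \<times> \<real>\<^sup>3\<close>. Covariant 2-tensors are bilinear forms; their components are the values on \<open>Basis\<close>,
  which consists of the coordinate vectors.
\<close>

definition flrw_metric ::
  "real \<Rightarrow> (real \<Rightarrow> real) \<Rightarrow> (real^3 \<Rightarrow> real \<times> (real^3)) \<Rightarrow>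
   real \<times> (real^3) \<Rightarrow> real \<times> (real^3) \<Rightarrow> real \<times> (real^3) \<Rightarrow> real" where
  "flrw_metric k a \<phi> z X Y =
     - (fst X * fst Y) + (a (fst z))\<^sup>2 * space_metric k \<phi> (snd z) (snd X) (snd Y)"

text \<open>The convention for \<open>sqrt (-g)\<close>, signed where \<open>a < 0\<close>:\<close>

definition volume_density ::
  "real \<Rightarrow> (real \<Rightarrow> real) \<Rightarrow> (real^3 \<Rightarrow> real \<times> (real^3)) \<Rightarrow> real \<times> (real^3) \<Rightarrow> real" where
  "volume_density k a \<phi> z = (a (fst z)) ^ 3 * sqrt_det_space k \<phi> (snd z)"

definition four_velocity :: "real \<times> (real^3)" where
  "four_velocity = (1, 0)"

text \<open>\<open>(\<rho> + p) u\<^sub>a u\<^sub>b + p g\<^sub>a\<^sub>b\<close> at a point where the metric is \<open>g\<close>, with \<open>u\<^sub>a = g\<^sub>a\<^sub>b u\<^sup>b\<close>:\<close>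

definition perfect_fluid ::
  "(real \<times> (real^3) \<Rightarrow> real \<times> (real^3) \<Rightarrow> real) \<Rightarrow> real \<Rightarrow> real \<Rightarrow>
   real \<times> (real^3) \<Rightarrow> real \<times> (real^3) \<Rightarrow> real" where
  "perfect_fluid g \<rho> p X Y = (\<rho> + p) * g X four_velocity * g Y four_velocity + p * g X Y"

end

theory Submission
  imports Defs
begin

text \<open>
  Multiplying by \<open>a\<^sup>3\<close> cancels every power of \<open>a\<close> in the denominators, so the densities are polynomials
  in \<open>a\<close> and its first two derivatives times \<open>sqrt (det g\<^sub>\<Sigma>)\<close>. The latter is smooth because
  \<open>det g\<^sub>\<Sigma> > 0\<close>: the form induced on the tangent spaces is positive definite, which for the hyperboloid
  is the statement that vectors Minkowski-orthogonal to a timelike vector are spacelike.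
\<close>

section \<open>Calculus of smooth functions\<close>

lemma Ck_on_cong:
  assumes "Ck_on n S f" "\<And>x. x \<in> S \<Longrightarrow> f x = g x"
  shows "Ck_on n S g"
proof (cases n)
  case 0
  then show ?thesis using assms continuous_on_cong[of S S f g] by simp
next
  case (Suc m)
  then obtain f' where f': "\<forall>x\<in>S. (f has_derivative f' x) (at x within S)"
    "\<forall>v. Ck_on m S (\<lambda>x. f' x v)"
    using assms(1) by auto
  have "\<forall>x\<in>S. (g has_derivative f' x) (at x within S)"
    using f'(1) assms(2) by (metis has_derivative_transform)
  with f'(2) Suc show ?thesis by auto
qed

lemma Ck_on_SucI:
  assumes "\<And>x. x \<in> S \<Longrightarrow> (f has_derivative f' x) (at x within S)"
    and "\<And>v. Ck_on n S (\<lambda>x. f' x v)"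
  shows "Ck_on (Suc n) S f"
  using assms by auto

lemma Ck_on_SucE:
  assumes "Ck_on (Suc n) S f"
  obtains f' where "\<And>x. x \<in> S \<Longrightarrow> (f has_derivative f' x) (at x within S)"
    and "\<And>v. Ck_on n S (\<lambda>x. f' x v)"
  using assms by auto

text \<open>Induction moves the claim to the derivative; at the bottom it is that differentiability
  implies continuity. Product, reciprocal and square root rules need it because the undifferentiated
  functions reappear in their derivatives.\<close>

lemma Ck_on_Suc_imp_Ck_on:
  assumes "Ck_on (Suc n) S f"
  shows "Ck_on n S f"
  using assms
proof (induction n arbitrary: f)
  case 0
  then show ?case
    by (auto simp: continuous_on_eq_continuous_within intro: has_derivative_continuous)
next
  case (Suc n)
  from Suc.prems obtain f' where "\<And>x. x \<in> S \<Longrightarrow> (f has_derivative f' x) (at x within S)"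
    and "\<And>v. Ck_on (Suc n) S (\<lambda>x. f' x v)"
    by (rule Ck_on_SucE) blast
  then show ?case using Suc.IH by (blast intro: Ck_on_SucI)
qed

lemma Ck_on_const: "Ck_on n S (\<lambda>x. c)"
proof (induction n arbitrary: c)
  case (Suc n)
  show ?case by (rule Ck_on_SucI[where f' = "\<lambda>x v. 0"]) (auto intro: Suc.IH)
qed simp

lemma Ck_on_add:
  assumes "Ck_on n S f" "Ck_on n S g"
  shows "Ck_on n S (\<lambda>x. f x + g x)"
  using assms
proof (induction n arbitrary: f g)
  case 0
  then show ?case by (auto intro: continuous_on_add)
next
  case (Suc n)
  obtain f' where f': "\<And>x. x \<in> S \<Longrightarrow> (f has_derivative f' x) (at x within S)"
    "\<And>v. Ck_on n S (\<lambda>x. f' x v)"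
    using Suc.prems(1) by (rule Ck_on_SucE) blast
  obtain g' where g': "\<And>x. x \<in> S \<Longrightarrow> (g has_derivative g' x) (at x within S)"
    "\<And>v. Ck_on n S (\<lambda>x. g' x v)"
    using Suc.prems(2) by (rule Ck_on_SucE) blast
  show ?case
    by (rule Ck_on_SucI[where f' = "\<lambda>x v. f' x v + g' x v"])
      (intro has_derivative_add f' g' Suc.IH; assumption)+
qed

text \<open>The Leibniz rule, proved once for all bounded bilinear pairings; it is used below for
  real multiplication and for the inner product.\<close>

lemma (in bounded_bilinear) Ck_on:
  assumes "Ck_on n S f" "Ck_on n S g"
  shows "Ck_on n S (\<lambda>x. prod (f x) (g x))"
  using assms
proof (induction n arbitrary: f g)
  case 0
  then show ?case by (auto intro: continuous_on)
next
  case (Suc n)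
  obtain f' where f': "\<And>x. x \<in> S \<Longrightarrow> (f has_derivative f' x) (at x within S)"
    "\<And>v. Ck_on n S (\<lambda>x. f' x v)"
    using Suc.prems(1) by (rule Ck_on_SucE) blast
  obtain g' where g': "\<And>x. x \<in> S \<Longrightarrow> (g has_derivative g' x) (at x within S)"
    "\<And>v. Ck_on n S (\<lambda>x. g' x v)"
    using Suc.prems(2) by (rule Ck_on_SucE) blast
  have "Ck_on n S f" "Ck_on n S g"
    using Suc.prems by (simp_all only: Ck_on_Suc_imp_Ck_on)
  then show ?case
    by (intro Ck_on_SucI[where f' = "\<lambda>x v. prod (f x) (g' x v) + prod (f' x v) (g x)"]
        FDERIV f' g' Ck_on_add Suc.IH)
qed

lemma (in bounded_linear) Ck_on_compose_left:
  assumes "Ck_on n S g"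
  shows "Ck_on n S (\<lambda>x. f (g x))"
  using assms
proof (induction n arbitrary: g)
  case 0
  then show ?case by (auto intro: continuous_on)
next
  case (Suc n)
  obtain g' where g': "\<And>x. x \<in> S \<Longrightarrow> (g has_derivative g' x) (at x within S)"
    "\<And>v. Ck_on n S (\<lambda>x. g' x v)"
    using Suc.prems by (rule Ck_on_SucE) blast
  show ?case
    by (rule Ck_on_SucI[where f' = "\<lambda>x v. f (g' x v)"])
      (intro has_derivative g' Suc.IH; assumption)+
qed

text \<open>For a linear inner map the chain rule gives \<open>g' (f x) (f v)\<close>, whose
  direction \<open>f v\<close> does not vary with \<open>x\<close>. The induction hypothesis
  therefore applies to \<open>g'\<close> in a fixed direction.\<close>

lemma (in bounded_linear) Ck_on_compose_right:
  assumes "Ck_on n T g" "f ` S \<subseteq> T"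
  shows "Ck_on n S (\<lambda>x. g (f x))"
  using assms(1)
proof (induction n arbitrary: g)
  case 0
  then show ?case
    using continuous_on_compose2[of T g S f] assms(2) linear_continuous_on[OF bounded_linear_axioms]
    by auto
next
  case (Suc n)
  obtain g' where g': "\<And>x. x \<in> T \<Longrightarrow> (g has_derivative g' x) (at x within T)"
    "\<And>v. Ck_on n T (\<lambda>x. g' x v)"
    using Suc.prems by (rule Ck_on_SucE) blast
  show ?case
  proof (rule Ck_on_SucI[where f' = "\<lambda>x v. g' (f x) (f v)"])
    fix x assume x: "x \<in> S"
    \<comment> \<open>The chain rule within sets asks for the derivative within the image of
      \<open>S\<close>, so the one within \<open>T\<close> is restricted.\<close>
    have "(g has_derivative g' (f x)) (at (f x) within f ` S)"
      using g'(1) x assms(2) has_derivative_subset by blast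
    then show "((\<lambda>x. g (f x)) has_derivative (\<lambda>v. g' (f x) (f v))) (at x within S)"
      by (rule has_derivative_in_compose[rotated]) (rule bounded_linear_imp_has_derivative[OF bounded_linear_axioms])
  qed (intro Suc.IH g')
qed

text \<open>The derivative of \<open>1/f\<close> is a polynomial in \<open>1/f\<close> and
  \<open>f'\<close>, so order \<open>n\<close> for \<open>1/f\<close> yields order \<open>n\<close>
  for its derivative and the induction closes.\<close>

lemma Ck_on_inverse:
  fixes f :: "'a::real_normed_vector \<Rightarrow> real"
  assumes "Ck_on n S f" "\<And>x. x \<in> S \<Longrightarrow> f x \<noteq> 0"
  shows "Ck_on n S (\<lambda>x. inverse (f x))"
  using assms(1)
proof (induction n)
  case 0
  then show ?case using assms(2) by (auto intro: continuous_on_inverse)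
next
  case (Suc n)
  have IH: "Ck_on n S (\<lambda>x. inverse (f x))"
    using Suc.IH[OF Ck_on_Suc_imp_Ck_on[OF Suc.prems]] .
  obtain f' where f': "\<And>x. x \<in> S \<Longrightarrow> (f has_derivative f' x) (at x within S)"
    "\<And>v. Ck_on n S (\<lambda>x. f' x v)"
    using Suc.prems by (rule Ck_on_SucE) blast
  show ?case
  proof (rule Ck_on_SucI[where f' = "\<lambda>x v. - (inverse (f x) * f' x v * inverse (f x))"])
    show "Ck_on n S (\<lambda>x. - (inverse (f x) * f' x v * inverse (f x)))" for v
      by (intro bounded_linear.Ck_on_compose_left[OF bounded_linear_minus[OF bounded_linear_ident]]
          bounded_bilinear.Ck_on[OF bounded_bilinear_mult] IH f')
  qed (use f' assms(2) in \<open>auto intro: has_derivative_inverse\<close>)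
qed

text \<open>The same bootstrapping: \<open>f' / (2 * sqrt f)\<close> involves \<open>sqrt f\<close>
  itself one order lower, and strict positivity allows the division.\<close>

lemma Ck_on_sqrt:
  fixes f :: "'a::real_normed_vector \<Rightarrow> real"
  assumes "Ck_on n S f" "\<And>x. x \<in> S \<Longrightarrow> 0 < f x"
  shows "Ck_on n S (\<lambda>x. sqrt (f x))"
  using assms(1)
proof (induction n)
  case 0
  then show ?case by (auto intro: continuous_on_real_sqrt)
next
  case (Suc n)
  have IH: "Ck_on n S (\<lambda>x. sqrt (f x))"
    using Suc.IH[OF Ck_on_Suc_imp_Ck_on[OF Suc.prems]] .
  obtain f' where f': "\<And>x. x \<in> S \<Longrightarrow> (f has_derivative f' x) (at x within S)"
    "\<And>v. Ck_on n S (\<lambda>x. f' x v)"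
    using Suc.prems by (rule Ck_on_SucE) blast
  show ?case
  proof (rule Ck_on_SucI[where f' = "\<lambda>x v. f' x v * (inverse (sqrt (f x)) * (1/2))"])
    show "Ck_on n S (\<lambda>x. f' x v * (inverse (sqrt (f x)) * (1/2)))" for v
      using assms(2)
      by (intro bounded_bilinear.Ck_on[OF bounded_bilinear_mult] Ck_on_inverse Ck_on_const IH f')
        (auto simp: less_imp_neq[THEN not_sym])
    show "((\<lambda>x. sqrt (f x)) has_derivative (\<lambda>v. f' x v * (inverse (sqrt (f x)) * (1/2)))) (at x within S)"
      if "x \<in> S" for x
      using that f' assms(2)[OF that]
      by (auto intro!: derivative_eq_intros simp: field_simps)
  qed
qed

section \<open>Smoothness of algebraic expressions\<close>

lemma smooth_on_const: "smooth_on S (\<lambda>x. c)"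
  by (simp add: smooth_on_def Ck_on_const)

lemma smooth_on_add:
  "smooth_on S f \<Longrightarrow> smooth_on S g \<Longrightarrow> smooth_on S (\<lambda>x. f x + g x)"
  by (simp add: smooth_on_def Ck_on_add)

lemma (in bounded_linear) smooth_on_compose_left:
  "smooth_on S g \<Longrightarrow> smooth_on S (\<lambda>x. f (g x))"
  by (simp add: smooth_on_def Ck_on_compose_left)

lemmas smooth_on_minus =
  bounded_linear.smooth_on_compose_left[OF bounded_linear_minus[OF bounded_linear_ident]]

lemma smooth_on_diff:
  "smooth_on S f \<Longrightarrow> smooth_on S g \<Longrightarrow> smooth_on S (\<lambda>x. f x - g x)"
  using smooth_on_add[of S f "\<lambda>x. - g x"] smooth_on_minus[of S g] by simp

lemma (in bounded_bilinear) smooth_on: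
  "smooth_on S f \<Longrightarrow> smooth_on S g \<Longrightarrow> smooth_on S (\<lambda>x. prod (f x) (g x))"
  by (simp add: smooth_on_def Ck_on)

lemmas smooth_on_mult = bounded_bilinear.smooth_on[OF bounded_bilinear_mult]

lemma smooth_on_power:
  fixes f :: "'a::real_normed_vector \<Rightarrow> real"
  shows "smooth_on S f \<Longrightarrow> smooth_on S (\<lambda>x. f x ^ m)"
  by (induction m) (auto intro: smooth_on_const smooth_on_mult)

lemma smooth_on_sum:
  "(\<And>i. i \<in> A \<Longrightarrow> smooth_on S (f i)) \<Longrightarrow> smooth_on S (\<lambda>x. \<Sum>i\<in>A. f i x)"
  by (induction A rule: infinite_finite_induct) (auto intro: smooth_on_const smooth_on_add)

lemma smooth_on_prod:
  fixes f :: "'i \<Rightarrow> 'a::real_normed_vector \<Rightarrow> real"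
  shows "(\<And>i. i \<in> A \<Longrightarrow> smooth_on S (f i)) \<Longrightarrow> smooth_on S (\<lambda>x. \<Prod>i\<in>A. f i x)"
  by (induction A rule: infinite_finite_induct) (auto intro: smooth_on_const smooth_on_mult)

lemma smooth_on_det:
  fixes M :: "'a::real_normed_vector \<Rightarrow> real^'n^'n"
  assumes "\<And>i j. smooth_on S (\<lambda>x. M x $ i $ j)"
  shows "smooth_on S (\<lambda>x. det (M x))"
  unfolding det_def by (intro smooth_on_sum smooth_on_mult smooth_on_const smooth_on_prod assms)

lemma smooth_on_sqrt:
  fixes f :: "'a::real_normed_vector \<Rightarrow> real"
  shows "smooth_on S f \<Longrightarrow> (\<And>x. x \<in> S \<Longrightarrow> 0 < f x) \<Longrightarrow> smooth_on S (\<lambda>x. sqrt (f x))"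
  by (simp add: smooth_on_def Ck_on_sqrt)

text \<open>This lemma and the next lift functions of time alone, or of space alone, to the
  spacetime coordinate domain.\<close>

lemma smooth_on_Times_fst: "smooth_on A f \<Longrightarrow> smooth_on (A \<times> B) (\<lambda>z. f (fst z))"
  unfolding smooth_on_def by (auto intro: bounded_linear.Ck_on_compose_right[OF bounded_linear_fst])

lemma smooth_on_Times_snd: "smooth_on B f \<Longrightarrow> smooth_on (A \<times> B) (\<lambda>z. f (snd z))"
  unfolding smooth_on_def by (auto intro: bounded_linear.Ck_on_compose_right[OF bounded_linear_snd])

section \<open>Smoothness of derivatives\<close>

lemma smooth_on_imp_differentiable:
  assumes "smooth_on S f" "open S" "x \<in> S"
  shows "f differentiable at x"
proof -
  have "Ck_on (Suc 0) S f" using assms(1) by (simp only: smooth_on_def)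
  then obtain f' where "\<And>x. x \<in> S \<Longrightarrow> (f has_derivative f' x) (at x within S)"
    by (rule Ck_on_SucE) blast
  then show ?thesis
    using assms(2,3) at_within_open[of x S] unfolding differentiable_def by metis
qed

lemma smooth_on_frechet_derivative:
  assumes "smooth_on S f" "open S"
  shows "smooth_on S (\<lambda>x. frechet_derivative f (at x) v)"
  unfolding smooth_on_def
proof
  fix n
  have "Ck_on (Suc n) S f" using assms(1) by (simp only: smooth_on_def)
  then obtain f' where f': "\<And>x. x \<in> S \<Longrightarrow> (f has_derivative f' x) (at x within S)"
    "\<And>v. Ck_on n S (\<lambda>x. f' x v)"
    by (rule Ck_on_SucE) blast
  \<comment> \<open>The witness \<open>f'\<close> may change with the order \<open>n\<close>. On an
    open set the derivative is unique, so every such witness agrees with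
    \<open>frechet_derivative\<close>.\<close>
  have "f' x v = frechet_derivative f (at x) v" if "x \<in> S" for x
    using f'(1)[OF that] that assms(2) frechet_derivative_at[of f "f' x" x]
      at_within_open[of x S] by simp
  then show "Ck_on n S (\<lambda>x. frechet_derivative f (at x) v)"
    using f'(2) by (rule Ck_on_cong[rotated])
qed

text \<open>A connected set with more than one point has no isolated points. This makes derivatives
  within the interval unique, also at endpoints, so that \<open>time_deriv\<close> is
  determined.\<close>

lemma at_within_interval_neq_bot:
  fixes I :: "real set"
  assumes "is_interval I" "\<exists>s\<in>I. \<exists>t\<in>I. s < t" "t \<in> I"
  shows "at t within I \<noteq> bot"
proof -
  have "connected I" using assms(1) by (simp add: is_interval_connected_1)
  moreover have "\<nexists>c. I = {c}" using assms(2) by auto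
  ultimately have "t islimpt I" using assms(3) by (simp add: connected_imp_perfect)
  then show ?thesis by (simp add: trivial_limit_within)
qed

lemma smooth_on_time_deriv:
  assumes "is_interval I" "\<exists>s\<in>I. \<exists>t\<in>I. s < t" "smooth_on I a"
  shows "smooth_on I (time_deriv I a)"
  unfolding smooth_on_def
proof
  fix n
  have "Ck_on (Suc n) I a" using assms(3) by (simp only: smooth_on_def)
  then obtain a' where a': "\<And>t. t \<in> I \<Longrightarrow> (a has_derivative a' t) (at t within I)"
    "\<And>v. Ck_on n I (\<lambda>t. a' t v)"
    by (rule Ck_on_SucE) blast
  have "a' t 1 = time_deriv I a t" if "t \<in> I" for t
  proof -
    \<comment> \<open>A linear map on the reals is determined by its value at 1, so the witness in
      direction 1 is the vector derivative.\<close>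
    have "a' t h = h *\<^sub>R a' t 1" for h
      using linear_cmul[OF has_derivative_linear[OF a'(1)[OF that]], of h 1] by simp
    then have "a' t = (\<lambda>h. h *\<^sub>R a' t 1)" by (rule ext)
    then have "(a has_vector_derivative a' t 1) (at t within I)"
      using a'(1)[OF that] unfolding has_vector_derivative_def by metis
    then show ?thesis
      using vector_derivative_within[OF at_within_interval_neq_bot[OF assms(1,2) that], of a "a' t 1"]
      by (simp add: time_deriv_def)
  qed
  then show "Ck_on n I (time_deriv I a)"
    using a'(2) by (rule Ck_on_cong[rotated])
qed

section \<open>Positivity of the metric determinant\<close>

text \<open>
  The segment from the identity to \<open>A\<close> consists of invertible matrices, so the determinant keeps its
  sign along it.
\<close>

lemma det_pos_if_pos_definite:
  fixes A :: "real^'n^'n"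
  assumes "\<And>x. x \<noteq> 0 \<Longrightarrow> 0 < x \<bullet> (A *v x)"
  shows "0 < det A"
proof (rule ccontr)
  assume "\<not> 0 < det A"
  define B where "B s = (1 - s) *\<^sub>R mat 1 + s *\<^sub>R A" for s :: real
  have "continuous_on {0..1} (\<lambda>s. det (B s))"
    unfolding B_def det_def by (simp, intro continuous_intros)
  moreover have "B 0 = mat 1" "B 1 = A" by (simp_all add: B_def)
  ultimately obtain s where s: "0 \<le> s" "s \<le> 1" "det (B s) = 0"
    using IVT2'[of "\<lambda>s. det (B s)" 1 0 0] \<open>\<not> 0 < det A\<close> by auto
  then have "\<not> invertible (B s)" by (simp add: invertible_det_nz)
  then obtain x where x: "x \<noteq> 0" "B s *v x = 0"
    by (auto simp: invertible_left_inverse matrix_left_invertible_ker)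
  have "x \<bullet> (B s *v x) = (1 - s) * (x \<bullet> x) + s * (x \<bullet> (A *v x))"
    by (simp add: B_def matrix_vector_mult_add_rdistrib scaleR_matrix_vector_assoc[symmetric] inner_add_right)
  moreover have "0 < x \<bullet> x" "0 < x \<bullet> (A *v x)" using x assms by auto
  \<comment> \<open>Both summands are nonnegative; the first is positive for \<open>s = 0\<close>,
    the second otherwise.\<close>
  ultimately have "0 < x \<bullet> (B s *v x)"
    using s by (cases "s = 0") (auto intro!: add_nonneg_pos)
  with x(2) show False by simp
qed

text \<open>Both arguments are expanded in the standard basis. This transfers positivity from the
  metric as a form to its coordinate matrix.\<close>

lemma inner_gram_matrix_eq:
  fixes B :: "real^'n \<Rightarrow> real^'n \<Rightarrow> real"
  assumes "bilinear B"
  shows "x \<bullet> ((\<chi> i j. B (axis i 1) (axis j 1)) *v y) = B x y"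
proof -
  have l: "linear (B u)" "linear (\<lambda>u. B u w)" for u w
    using assms by (auto simp: bilinear_def)
  have "B x y = B (\<Sum>i\<in>UNIV. (x $ i) *\<^sub>R axis i 1) (\<Sum>j\<in>UNIV. (y $ j) *\<^sub>R axis j 1)"
    using basis_expansion[of x] basis_expansion[of y] by (simp add: scalar_mult_eq_scaleR)
  also have "\<dots> = (\<Sum>i\<in>UNIV. \<Sum>j\<in>UNIV. x $ i * (y $ j * B (axis i 1) (axis j 1)))"
    unfolding linear_sum[OF l(2)] linear_cmul[OF l(2)] unfolding linear_sum[OF l(1)] linear_cmul[OF l(1)]
    by (simp add: sum_distrib_left)
  finally show ?thesis
    by (simp add: inner_vec_def matrix_vector_mult_def sum_distrib_left mult_ac)
qed

section \<open>The metric induced on the space forms\<close>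

lemma bilinear_space_metric:
  assumes "\<phi> differentiable at q"
  shows "bilinear (space_metric k \<phi> q)"
proof -
  have "linear (frechet_derivative \<phi> (at q))"
    using assms by (rule linear_frechet_derivative)
  then show ?thesis
    unfolding bilinear_def space_metric_def ambient_form_def
    by (auto simp: linear_iff algebra_simps)
qed

text \<open>The Minkowski square of the position vector is constant along the chart; differentiating
  it shows that tangent vectors are Minkowski-orthogonal to \<open>\<phi> q\<close>.\<close>

lemma hyperboloid_tangent:
  fixes \<phi> :: "real^3 \<Rightarrow> real \<times> (real^3)"
  assumes "open U" "\<phi> ` U \<subseteq> space_form (-1)" "q \<in> U" "(\<phi> has_derivative D) (at q)"
  shows "fst (\<phi> q) * fst (D v) = snd (\<phi> q) \<bullet> snd (D v)"
proof -
  let ?f = "\<lambda>x. fst (\<phi> x) * fst (\<phi> x) - snd (\<phi> x) \<bullet> snd (\<phi> x)"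
  have f1: "?f x = 1" if "x \<in> U" for x
  proof -
    have "\<phi> x \<in> space_form (-1)" using assms(2) that by blast
    then have "(fst (\<phi> x))\<^sup>2 - (norm (snd (\<phi> x)))\<^sup>2 = 1" by (simp add: space_form_def)
    then show ?thesis by (simp only: power2_norm_eq_inner power2_eq_square[of "fst (\<phi> x)"])
  qed
  \<comment> \<open>Being constant near \<open>q\<close> gives derivative zero; the product rule
    computes the same derivative, and uniqueness equates the two.\<close>
  have "(?f has_derivative (\<lambda>v. 0)) (at q)"
    by (rule has_derivative_transform_within_open[OF has_derivative_const[of 1] assms(1,3)])
      (simp add: f1)
  moreover have "(?f has_derivative (\<lambda>v. fst (\<phi> q) * fst (D v) + fst (D v) * fst (\<phi> q)
      - (snd (\<phi> q) \<bullet> snd (D v) + snd (D v) \<bullet> snd (\<phi> q)))) (at q)"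
    by (intro has_derivative_diff has_derivative_mult has_derivative_inner
        has_derivative_fst has_derivative_snd assms(4))
  ultimately have "(\<lambda>v. 0) = (\<lambda>v. fst (\<phi> q) * fst (D v) + fst (D v) * fst (\<phi> q)
      - (snd (\<phi> q) \<bullet> snd (D v) + snd (D v) \<bullet> snd (\<phi> q)))"
    by (rule has_derivative_unique)
  from fun_cong[OF this, of v] show ?thesis by (simp add: inner_commute mult.commute)
qed

text \<open>Here \<open>(s, x)\<close> is unit timelike. Cauchy-Schwarz bounds
  \<open>(s * r)\<^sup>2\<close> by the product of the squared norms of \<open>x\<close> and
  \<open>w\<close>, and the squared norm of \<open>x\<close> is \<open>s\<^sup>2 - 1\<close>,
  strictly below \<open>s\<^sup>2\<close>.\<close>

lemma minkowski_orthogonal_spacelike: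
  fixes x w :: "'a::real_inner"
  assumes "s\<^sup>2 - (norm x)\<^sup>2 = 1" "s * r = x \<bullet> w" "(r, w) \<noteq> 0"
  shows "0 < - (r * r) + w \<bullet> w"
proof -
  have s: "s\<^sup>2 \<ge> 1" using assms(1) zero_le_power2[of "norm x"] by linarith
  \<comment> \<open>If \<open>w\<close> vanished, then \<open>s * r = 0\<close> with
    \<open>s\<close> nonzero would force \<open>r = 0\<close> too.\<close>
  have "w \<noteq> 0"
    using assms s by (auto simp: zero_prod_def)
  have "s\<^sup>2 * (r * r) = (x \<bullet> w)\<^sup>2"
    by (simp flip: assms(2) add: power2_eq_square)
  also have "\<dots> \<le> (norm x)\<^sup>2 * (w \<bullet> w)"
    using Cauchy_Schwarz_ineq[of x w] by (simp add: power2_norm_eq_inner)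
  also have "\<dots> < s\<^sup>2 * (w \<bullet> w)"
    using assms(1) \<open>w \<noteq> 0\<close> by (intro mult_strict_right_mono) auto
  finally show ?thesis using s by (simp add: mult_less_cancel_left)
qed

text \<open>An immersion sends \<open>v\<close> to a nonzero tangent vector. For the Euclidean
  ambient form that suffices; for the indefinite one, tangency to the hyperboloid is what excludes
  null and timelike vectors.\<close>

lemma space_metric_pos:
  assumes "k \<in> {1, 0, -1}" "local_coords k U \<phi>" "q \<in> U" "v \<noteq> 0"
  shows "0 < space_metric k \<phi> q v v"
proof -
  define D where "D = frechet_derivative \<phi> (at q)"
  have U: "open U" and inj: "inj D" and sub: "\<phi> ` U \<subseteq> space_form k"
    and diff: "\<phi> differentiable at q"
    using assms(2,3) unfolding local_coords_def D_def
    by (blast intro: smooth_on_imp_differentiable dest: openin_imp_subset)+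
  then have D: "(\<phi> has_derivative D) (at q)"
    unfolding D_def by (simp add: frechet_derivative_works)
  have Dv: "D v \<noteq> 0"
    using inj assms(4) linear_injective_0[OF has_derivative_linear[OF D]] by auto
  show ?thesis
  proof (cases "k = -1")
    case True
    have "\<phi> q \<in> space_form (-1)" using sub assms(3) True by auto
    then have "(fst (\<phi> q))\<^sup>2 - (norm (snd (\<phi> q)))\<^sup>2 = 1" by (simp add: space_form_def)
    then have "0 < - (fst (D v) * fst (D v)) + snd (D v) \<bullet> snd (D v)"
      using hyperboloid_tangent[OF U _ assms(3) D] sub True Dv
      by (intro minkowski_orthogonal_spacelike) auto
    then show ?thesis using True by (simp add: space_metric_def ambient_form_def D_def)
  next
    case False
    then show ?thesis using Dv by (simp add: space_metric_def ambient_form_def D_def)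
  qed
qed

lemma det_space_metric_pos:
  assumes "k \<in> {1, 0, -1}" "local_coords k U \<phi>" "q \<in> U"
  shows "0 < det (space_metric_matrix k \<phi> q)"
proof (rule det_pos_if_pos_definite)
  fix v :: "real^3" assume "v \<noteq> 0"
  have "\<phi> differentiable at q"
    using assms(2,3) smooth_on_imp_differentiable by (auto simp: local_coords_def)
  then show "0 < v \<bullet> (space_metric_matrix k \<phi> q *v v)"
    using space_metric_pos[OF assms \<open>v \<noteq> 0\<close>]
    by (simp add: space_metric_matrix_def inner_gram_matrix_eq bilinear_space_metric)
qed

lemma smooth_on_space_metric:
  assumes "smooth_on U \<phi>" "open U"
  shows "smooth_on U (\<lambda>q. space_metric k \<phi> q v w)"
proof -
  note D = smooth_on_frechet_derivative[OF assms]
  note fst = bounded_linear.smooth_on_compose_left[OF bounded_linear_fst]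
  note snd = bounded_linear.smooth_on_compose_left[OF bounded_linear_snd]
  note inner = bounded_bilinear.smooth_on[OF bounded_bilinear_inner]
  show ?thesis
    unfolding space_metric_def ambient_form_def
    by (cases "k = -1") (simp_all add: smooth_on_diff smooth_on_mult inner fst snd D)
qed

lemma smooth_on_sqrt_det_space:
  assumes "k \<in> {1, 0, -1}" "local_coords k U \<phi>"
  shows "smooth_on U (sqrt_det_space k \<phi>)"
proof -
  have "smooth_on U (\<lambda>q. det (space_metric_matrix k \<phi> q))"
    using assms(2)
    by (intro smooth_on_det) (simp add: space_metric_matrix_def smooth_on_space_metric local_coords_def)
  then show ?thesis
    unfolding sqrt_det_space_def[abs_def] by (rule smooth_on_sqrt) (rule det_space_metric_pos[OF assms])
qed

section \<open>The densitized fluid\<close>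

lemma smooth_on_perfect_fluid_flrw:
  assumes "smooth_on I a" "smooth_on U \<phi>" "open U"
    and "smooth_on (I \<times> U) R" "smooth_on (I \<times> U) P"
  shows "smooth_on (I \<times> U) (\<lambda>z. perfect_fluid (flrw_metric k a \<phi> z) (R z) (P z) X Y)"
  unfolding perfect_fluid_def flrw_metric_def
  by (intro smooth_on_add smooth_on_mult smooth_on_power smooth_on_const assms(4,5)
      smooth_on_Times_fst[OF assms(1)] smooth_on_Times_snd[OF smooth_on_space_metric[OF assms(2,3)]])

text \<open>The fluid tensor is linear in the pair of density and pressure, so it can be densitized
  by densitizing the two scalars.\<close>

lemma perfect_fluid_mult_right:
  "perfect_fluid g (\<rho> * c) (p * c) X Y = perfect_fluid g \<rho> p X Y * c"
  by (simp add: perfect_fluid_def algebra_simps)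

theorem theorem3p1:
  fixes \<kappa> k :: real
    and I :: "real set"
    and a \<rho> p :: "real \<Rightarrow> real"
    and U :: "(real^3) set"
    and \<phi> :: "real^3 \<Rightarrow> real \<times> (real^3)"
  assumes "\<kappa> > 0"
    and "k \<in> {1, 0, -1}"
    and "is_interval I" and "\<exists>s\<in>I. \<exists>t\<in>I. s < t"
    and "smooth_on I a"
    and Friedmann: "\<And>t. t \<in> I \<Longrightarrow> a t \<noteq> 0 \<Longrightarrow>
           \<rho> t = 3 / \<kappa> * (((time_deriv I a t)\<^sup>2 + k) / (a t)\<^sup>2)"
    and acceleration: "\<And>t. t \<in> I \<Longrightarrow> a t \<noteq> 0 \<Longrightarrow>
           \<rho> t + 3 * p t = - (6 / \<kappa>) * (time_deriv I (time_deriv I a) t / a t)"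
    and "local_coords k U \<phi>"
  shows "\<exists>(R :: real \<times> (real^3) \<Rightarrow> real) (P :: real \<times> (real^3) \<Rightarrow> real)
           (T :: real \<times> (real^3) \<Rightarrow> real \<times> (real^3) \<Rightarrow> real \<times> (real^3) \<Rightarrow> real).
     smooth_on (I \<times> U) R \<and> smooth_on (I \<times> U) P \<and>
     (\<forall>X\<in>Basis. \<forall>Y\<in>Basis. smooth_on (I \<times> U) (\<lambda>z. T z X Y)) \<and>
     (\<forall>t\<in>I. \<forall>q\<in>U. a t \<noteq> 0 \<longrightarrow>
        R (t, q) = \<rho> t * volume_density k a \<phi> (t, q) \<and>
        P (t, q) = p t * volume_density k a \<phi> (t, q) \<and>
        (\<forall>X\<in>Basis. \<forall>Y\<in>Basis. T (t, q) X Y =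
           perfect_fluid (flrw_metric k a \<phi> (t, q)) (\<rho> t) (p t) X Y * volume_density k a \<phi> (t, q))) \<and>
     (\<forall>t\<in>I. \<forall>q\<in>U.
        R (t, q) = 3 / \<kappa> * ((time_deriv I a t)\<^sup>2 + k) * a t * sqrt_det_space k \<phi> q \<and>
        R (t, q) + 3 * P (t, q) =
          - (6 / \<kappa>) * time_deriv I (time_deriv I a) t * (a t)\<^sup>2 * sqrt_det_space k \<phi> q \<and>
        (\<forall>X\<in>Basis. \<forall>Y\<in>Basis. T (t, q) X Y =
           perfect_fluid (flrw_metric k a \<phi> (t, q)) (R (t, q)) (P (t, q)) X Y))"
proof -
  define d where "d = time_deriv I a"
  define s where "s = sqrt_det_space k \<phi>"
  \<comment> \<open>The Friedmann equation times \<open>a^3 * s\<close>, with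
    \<open>a^3 / a^2\<close> cancelled to \<open>a\<close>. The signed cube matters: its absolute
    value would leave the absolute value of \<open>a\<close>, which need not be smooth at a
    zero.\<close>
  define R where "R z = 3 / \<kappa> * ((d (fst z))\<^sup>2 + k) * a (fst z) * s (snd z)" for z
  \<comment> \<open>The acceleration equation times \<open>a^3 * s\<close>, with
    \<open>a^3 / a\<close> cancelled to \<open>a^2\<close>, solved for the pressure density.\<close>
  define P where "P z = 1 / 3 * (- (6 / \<kappa>) * time_deriv I d (fst z) * (a (fst z))\<^sup>2 * s (snd z) - R z)" for z
  \<comment> \<open>By linearity the densitized tensor is the fluid tensor of the densities, which
    has no denominators in \<open>a\<close>.\<close>
  define T where "T z = perfect_fluid (flrw_metric k a \<phi> z) (R z) (P z)" for z
  have U: "open U" "smooth_on U \<phi>"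
    using \<open>local_coords k U \<phi>\<close> by (auto simp: local_coords_def)
  have d: "smooth_on I d" "smooth_on I (time_deriv I d)"
    unfolding d_def using assms(3-5) by (simp_all add: smooth_on_time_deriv)
  have s: "smooth_on U s"
    unfolding s_def using assms by (intro smooth_on_sqrt_det_space)
  have R: "smooth_on (I \<times> U) R"
    unfolding R_def
    by (intro smooth_on_mult smooth_on_add smooth_on_power smooth_on_const
        smooth_on_Times_fst smooth_on_Times_snd d s \<open>smooth_on I a\<close>)
  have P: "smooth_on (I \<times> U) P"
    unfolding P_def
    by (intro smooth_on_mult smooth_on_diff smooth_on_power smooth_on_const
        smooth_on_Times_fst smooth_on_Times_snd d s R \<open>smooth_on I a\<close>)
  have T: "smooth_on (I \<times> U) (\<lambda>z. T z X Y)" for X Y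
    unfolding T_def using \<open>smooth_on I a\<close> U R P by (intro smooth_on_perfect_fluid_flrw)
  \<comment> \<open>The cancelled powers of \<open>a\<close> are restored here, which is legitimate
    only where \<open>a t\<close> is nonzero.\<close>
  have off_zero: "R (t, q) = \<rho> t * volume_density k a \<phi> (t, q)"
    "P (t, q) = p t * volume_density k a \<phi> (t, q)"
    if "t \<in> I" "a t \<noteq> 0" for t q
  proof -
    show R_eq: "R (t, q) = \<rho> t * volume_density k a \<phi> (t, q)"
      using Friedmann[OF that] that
      by (simp add: R_def d_def s_def volume_density_def power2_eq_square power3_eq_cube)
    have "(\<rho> t + 3 * p t) * volume_density k a \<phi> (t, q) =
        - (6 / \<kappa>) * time_deriv I d t * (a t)\<^sup>2 * s q"
      using acceleration[OF that] that
      by (simp add: d_def s_def volume_density_def power2_eq_square power3_eq_cube)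
    then have "P (t, q) = 1 / 3 * ((\<rho> t + 3 * p t) * volume_density k a \<phi> (t, q) - R (t, q))"
      by (simp only: P_def fst_conv snd_conv)
    then show "P (t, q) = p t * volume_density k a \<phi> (t, q)"
      by (simp add: R_eq algebra_simps)
  qed
  \<comment> \<open>The remaining identities are read off the definitions and so hold at zeros of
    \<open>a\<close> as well; there they fix the meaning of the densities.\<close>
  have R_eq: "R (t, q) = 3 / \<kappa> * ((time_deriv I a t)\<^sup>2 + k) * a t * sqrt_det_space k \<phi> q" for t q
    by (simp only: R_def d_def s_def fst_conv snd_conv)
  have RP_eq: "R (t, q) + 3 * P (t, q) =
      - (6 / \<kappa>) * time_deriv I (time_deriv I a) t * (a t)\<^sup>2 * sqrt_det_space k \<phi> q" for t q
    by (simp add: P_def d_def s_def field_simps)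
  have T_eq: "T (t, q) = perfect_fluid (flrw_metric k a \<phi> (t, q)) (R (t, q)) (P (t, q))" for t q
    by (simp only: T_def)
  show ?thesis
  proof (intro exI conjI ballI impI)
    show "T (t, q) X Y =
        perfect_fluid (flrw_metric k a \<phi> (t, q)) (\<rho> t) (p t) X Y * volume_density k a \<phi> (t, q)"
      if "t \<in> I" "a t \<noteq> 0" for t q X Y
      by (simp only: T_eq off_zero[OF that] perfect_fluid_mult_right)
  qed (rule R P T R_eq RP_eq T_eq[THEN fun_cong, THEN fun_cong] off_zero; assumption)+
qed

end
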